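(* Let $Y\subseteq 3\mathbb{N}+1$ and $W=3\mathbb{N}\cup Y$. Then there does not exist a minimal complement to $W$.
   Context: $\mathbb{N}$ is the set of nonnegative integers, $\mathbb{Z}$ the set of integers; $3\mathbb{N}=\{3n:n\in\mathbb{N}\}$ and $3\mathbb{N}+1=\{3n+1:n\in\mathbb{N}\}$. For $A,B\subseteq\mathbb{Z}$, $A+B=\{a+b: a\in A, b\in B\}$. A set $A\subseteq\mathbb{Z}$ is a complement to $B\subseteq\mathbb{Z}$ (in $\mathbb{Z}$) if $A+B=\mathbb{Z}$; it is a minimal complement to $B$ if in addition no proper subset of $A$ is a complement to $B$. The set $Y$ may be finite or infinite. *)

theory Defs
  imports Main "HOL-Library.Set_Algebras"
begin

text \<open>The sum \<open>A + B\<close> of two sets is the elementwise sum from \<^theory>\<open>HOL-Library.Set_Algebras\<close>.\<close>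

definition complement_to :: "int set \<Rightarrow> int set \<Rightarrow> bool" where
  "complement_to A B \<longleftrightarrow> A + B = UNIV"

definition minimal_complement_to :: "int set \<Rightarrow> int set \<Rightarrow> bool" where
  "minimal_complement_to A B \<longleftrightarrow>
     complement_to A B \<and> (\<forall>A'. A' \<subset> A \<longrightarrow> \<not> complement_to A' B)"

end

theory Submission
  imports Defs
begin

text \<open>
  Split a complement \<open>A\<close> of \<open>W\<close> into its parts in the residue classes modulo 3.
  Class \<open>r\<close> is covered by two kinds of sums: the part of \<open>A\<close> in class \<open>r\<close> plus a multiple
  of 3, and the part in class \<open>r - 1\<close> plus an element of \<open>Y\<close>.  Since \<open>W\<close> is
  nonnegative, the two parts cannot both be bounded below (\<open>two_adjacent_classes\<close>).  So at most
  one of the three parts is bounded below, and two cyclically adjacent parts, in classes \<open>s\<close> and \<open>s + 1\<close>, are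
  unbounded below.

  A part that is unbounded below covers its own class with the multiples of 3 alone
  (\<open>unbounded_class_covers\<close>), and this survives the loss of one element.  An element of the part
  in class \<open>s\<close> serves only the classes \<open>s\<close> and \<open>s + 1\<close>, which are thus covered without it, so
  it can be removed from \<open>A\<close>.  Hence no complement is minimal.
\<close>

definition unbounded_below_in_class :: "int set \<Rightarrow> int \<Rightarrow> bool" where
  "unbounded_below_in_class A r \<longleftrightarrow> (\<forall>k. \<exists>a\<in>A. a mod 3 = r mod 3 \<and> a \<le> k)"

lemma unbounded_class_covers:
  assumes "unbounded_below_in_class A x" and "{3 * int n | n. True} \<subseteq> W"
  shows "x \<in> A + W"
proof -
  obtain a where a: "a \<in> A" "a mod 3 = x mod 3" "a \<le> x"
    using assms(1) unfolding unbounded_below_in_class_def by blast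
  have "3 dvd x - a"
    using a(2) by (metis mod_eq_dvd_iff)
  then obtain m where m: "x - a = 3 * m" by (rule dvdE)
  then have "x - a = 3 * int (nat m)" using a(3) by simp
  then have "x - a \<in> W" using assms(2) by blast
  with a(1) have "a + (x - a) \<in> A + W" by (rule set_plus_intro)
  then show ?thesis by simp
qed

lemma unbounded_below_in_class_remove:
  assumes "unbounded_below_in_class A r"
  shows "unbounded_below_in_class (A - {b}) r"
  unfolding unbounded_below_in_class_def
proof
  fix k
  \<comment> \<open>An element below both \<open>k\<close> and \<open>b\<close> cannot be \<open>b\<close>.\<close>
  obtain a where "a \<in> A" "a mod 3 = r mod 3" "a \<le> min k (b - 1)"
    using assms unfolding unbounded_below_in_class_def by blast
  then show "\<exists>a\<in>A - {b}. a mod 3 = r mod 3 \<and> a \<le> k"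
    by (intro bexI[of _ a]) auto
qed

lemma sum_class:
  fixes a w :: int
  assumes "w mod 3 = 0 \<or> w mod 3 = 1"
  shows "(a + w) mod 3 = a mod 3 \<or> (a + w) mod 3 = (a + 1) mod 3"
  using assms by (metis add.right_neutral mod_add_right_eq)

lemma successor_class_eq_iff:
  fixes a r :: int
  shows "(a + 1) mod 3 = (r + 1) mod 3 \<longleftrightarrow> a mod 3 = r mod 3"
  by (simp add: mod_eq_dvd_iff)

text \<open>
  If both parts were bounded below, then so would be all sums that land in class \<open>r + 1\<close>, because
  adding an element of \<open>W\<close> never decreases a number.
\<close>

lemma two_adjacent_classes:
  assumes "A + W = UNIV" and W: "\<And>w. w \<in> W \<Longrightarrow> w \<ge> 0 \<and> (w mod 3 = 0 \<or> w mod 3 = 1)"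
  shows "unbounded_below_in_class A r \<or> unbounded_below_in_class A (r + 1)"
proof (rule ccontr)
  assume "\<not> ?thesis"
  then obtain k l where
    k: "\<And>a. a \<in> A \<Longrightarrow> a mod 3 = r mod 3 \<Longrightarrow> a > k" and
    l: "\<And>a. a \<in> A \<Longrightarrow> a mod 3 = (r + 1) mod 3 \<Longrightarrow> a > l"
    unfolding unbounded_below_in_class_def by (metis not_le)
  \<comment> \<open>Steps of length 3 lead down from \<open>r + 1\<close> to a number \<open>x\<close> that neither part can reach.\<close>
  define m where "m = max 0 (max (r + 1 - k) (r + 1 - l))"
  define x where "x = r + 1 - 3 * m"
  have "m \<ge> 0" "m \<ge> r + 1 - k" "m \<ge> r + 1 - l"
    unfolding m_def by auto
  then have x: "x \<le> k" "x \<le> l"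
    unfolding x_def by auto
  have x_mod: "x mod 3 = (r + 1) mod 3"
    unfolding x_def by presburger
  obtain a w where aw: "a \<in> A" "w \<in> W" "x = a + w"
    using assms(1) by (metis UNIV_I set_plus_elim)
  have "a \<le> x" and "w mod 3 = 0 \<or> w mod 3 = 1"
    using W[OF aw(2)] aw(3) by auto
  then have "a mod 3 = r mod 3 \<or> a mod 3 = (r + 1) mod 3"
    using sum_class[of w a] x_mod aw(3) successor_class_eq_iff[of a r] by metis
  then show False
    using k[OF aw(1)] l[OF aw(1)] x \<open>a \<le> x\<close> by linarith
qed

theorem corollary1:
  fixes Y W :: "int set"
  assumes "Y \<subseteq> {3 * int n + 1 | n. True}"
    and "W = {3 * int n | n. True} \<union> Y"
  shows "\<not> (\<exists>A. minimal_complement_to A W)"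
proof
  assume "\<exists>A. minimal_complement_to A W"
  then obtain A where cover: "A + W = UNIV"
    and minimal: "\<And>A'. A' \<subset> A \<Longrightarrow> A' + W \<noteq> UNIV"
    unfolding minimal_complement_to_def complement_to_def by blast
  have W: "w \<ge> 0 \<and> (w mod 3 = 0 \<or> w mod 3 = 1)" if w: "w \<in> W" for w
  proof -
    obtain n where "w = 3 * int n \<or> w = 3 * int n + 1"
      using w assms(1) unfolding assms(2) by blast
    then show ?thesis by presburger
  qed
  have multiples: "{3 * int n | n. True} \<subseteq> W"
    using assms(2) by blast
  have class_cong: "unbounded_below_in_class A r \<longleftrightarrow> unbounded_below_in_class A s"
    if "r mod 3 = s mod 3" for r s
    unfolding unbounded_below_in_class_def that ..
  note adjacent = two_adjacent_classes[OF cover W]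
  obtain s where s: "unbounded_below_in_class A s" "unbounded_below_in_class A (s + 1)"
  proof (cases "\<forall>r. unbounded_below_in_class A r")
    case True
    then show ?thesis using that by blast
  next
    case False
    \<comment> \<open>Both neighbours \<open>r + 1\<close> and \<open>r + 2 \<equiv> r - 1\<close> of a class with a bounded part have
      unbounded parts.\<close>
    then obtain r where r: "\<not> unbounded_below_in_class A r" by blast
    have "unbounded_below_in_class A (r + 1)"
      using adjacent[of r] r by blast
    moreover have "unbounded_below_in_class A (r - 1)"
      using adjacent[of "r - 1"] r by simp
    moreover have "(r - 1) mod 3 = (r + 1 + 1) mod 3"
      by presburger
    ultimately show ?thesis
      using that[of "r + 1"] class_cong[of "r - 1" "r + 1 + 1"] by simp
  qed
  obtain b where b: "b \<in> A" "b mod 3 = s mod 3"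
    using s(1) unfolding unbounded_below_in_class_def by blast
  have "x \<in> (A - {b}) + W" for x
  proof (cases "x mod 3 = s mod 3 \<or> x mod 3 = (s + 1) mod 3")
    case True
    then have "unbounded_below_in_class A x"
      using s class_cong[of x s] class_cong[of x "s + 1"] by blast
    then show ?thesis
      by (intro unbounded_class_covers unbounded_below_in_class_remove multiples)
  next
    case False
    obtain a w where aw: "a \<in> A" "w \<in> W" "x = a + w"
      using cover by (metis UNIV_I set_plus_elim)
    have "w mod 3 = 0 \<or> w mod 3 = 1"
      using W[OF aw(2)] by blast
    then have "a mod 3 \<noteq> s mod 3"
      using sum_class[of w a] False aw(3) successor_class_eq_iff[of a s] by metis
    with b(2) have "a \<noteq> b" by blast
    with aw show ?thesis by (auto intro: set_plus_intro)
  qed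
  then have "(A - {b}) + W = UNIV" by blast
  with minimal[of "A - {b}"] b(1) show False by blast
qed

end
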